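(* Let $\tau>1$ be a Salem number of degree $d$ and, for $n\in\mathbb{N}$, let $P_n(x)=1+a_{1,n}x+a_{2,n}x^2+\cdots+a_{d-1,n}x^{d-1}+x^d$ be the minimal polynomial of $\tau^n$ over $\mathbb{Q}$. Then (a) $\displaystyle\lim_{n\to\infty}\frac{a_{d-1,n+1}}{a_{d-1,n}}=\tau$ and $\displaystyle\lim_{n\to\infty}\sqrt[n]{|a_{d-1,n}|}=\tau$; (b) $\tau^n+\tau^{-n}\le |a_{d-1,n}|+d-2$ for every $n\in\mathbb{N}$; (c) for every $n\in\mathbb{N}$ and $k=1,2,\ldots,d-3$, $$|a_{d-k-1,n}|\le \binom{d-2}{k}\big(|a_{d-1,n}|+d-2\big)+\binom{d-2}{k-1}+\binom{d-2}{k+1}.$$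
   Context: A Salem number is a real algebraic integer $\tau>1$ of degree at least four, conjugate to $\tau^{-1}$, all of whose conjugates other than $\tau$ and $\tau^{-1}$ lie on the unit circle $|z|=1$. If $\tau$ is a Salem number of degree $d$, then $\tau^n$ is a Salem number of the same degree $d$ for every $n\in\mathbb{N}$, and its minimal polynomial is monic and reciprocal. *)

theory Defs
  imports Complex_Main "HOL-Computational_Algebra.Computational_Algebra"
begin

(* Unspecified when x is transcendental; min_rat_poly_unique covers the algebraic case. *)
definition min_rat_poly :: "'a :: field_char_0 \<Rightarrow> rat poly" where
  "min_rat_poly x = (THE p. lead_coeff p = 1 \<and> poly (map_poly of_rat p) x = 0 \<and>
     (\<forall>q. q \<noteq> 0 \<longrightarrow> poly (map_poly of_rat q) x = 0 \<longrightarrow> degree p \<le> degree q))"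

definition alg_degree :: "'a :: field_char_0 \<Rightarrow> nat" where
  "alg_degree x = degree (min_rat_poly x)"

definition alg_conjugates :: "'a :: field_char_0 \<Rightarrow> complex set" where
  "alg_conjugates x = {z. poly (map_poly of_rat (min_rat_poly x)) z = 0}"

definition salem_number :: "real \<Rightarrow> bool" where
  "salem_number \<tau> \<longleftrightarrow> algebraic_int \<tau> \<and> \<tau> > 1 \<and> alg_degree \<tau> \<ge> 4 \<and>
     complex_of_real (inverse \<tau>) \<in> alg_conjugates \<tau> \<and>
     (\<forall>z \<in> alg_conjugates \<tau> - {complex_of_real \<tau>, complex_of_real (inverse \<tau>)}. cmod z = 1)"

lemma min_rat_poly_unique:
  fixes x :: "'a :: field_char_0"
  assumes "algebraic x"
  shows "\<exists>!p. lead_coeff p = 1 \<and> poly (map_poly of_rat p) x = 0 \<and>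
     (\<forall>q. q \<noteq> 0 \<longrightarrow> poly (map_poly of_rat q) x = 0 \<longrightarrow> degree p \<le> degree q)"
proof -
  let ?R = "\<lambda>p. poly (map_poly of_rat p) x = 0"
  have diff: "map_poly of_rat (p - q) = (map_poly of_rat p - map_poly of_rat q :: 'a poly)" for p q
    by (rule poly_eqI) (simp add: coeff_map_poly of_rat_diff)
  have scale: "map_poly of_rat (smult c p) = (smult (of_rat c) (map_poly of_rat p) :: 'a poly)" for c p
    by (rule poly_eqI) (simp add: coeff_map_poly of_rat_mult)
  obtain r where r: "r \<noteq> 0" "poly (map_poly of_int r) x = 0"
    using assms by (rule algebraicE')
  define q :: "rat poly" where "q = map_poly of_int r"
  have "map_poly of_rat q = (map_poly of_int r :: 'a poly)"
    by (rule poly_eqI) (simp add: q_def coeff_map_poly)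
  moreover have "coeff q (degree r) \<noteq> 0"
    using r(1) by (simp add: q_def coeff_map_poly)
  ultimately have q: "?R q" "q \<noteq> 0" using r(2) by auto
  define m where "m = (ARG_MIN degree q. q \<noteq> 0 \<and> ?R q)"
  have "(m \<noteq> 0 \<and> ?R m) \<and> (\<forall>q. q \<noteq> 0 \<and> ?R q \<longrightarrow> degree m \<le> degree q)"
    unfolding m_def by (rule arg_min_nat_lemma) (use q in blast)
  then have m: "m \<noteq> 0" "?R m"
    and least: "\<And>q. q \<noteq> 0 \<Longrightarrow> ?R q \<Longrightarrow> degree m \<le> degree q" by blast+
  show ?thesis
  proof (rule ex1I)
    show "lead_coeff (smult (inverse (lead_coeff m)) m) = 1 \<and>
      ?R (smult (inverse (lead_coeff m)) m) \<and>
      (\<forall>q. q \<noteq> 0 \<longrightarrow> ?R q \<longrightarrow> degree (smult (inverse (lead_coeff m)) m) \<le> degree q)"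
      using m least by (simp add: scale)
  next
    show "p = smult (inverse (lead_coeff m)) m" if p: "lead_coeff p = 1 \<and> ?R p \<and>
      (\<forall>q. q \<noteq> 0 \<longrightarrow> ?R q \<longrightarrow> degree p \<le> degree q)" for p
    proof (rule ccontr)
      let ?n = "smult (inverse (lead_coeff m)) m"
      assume "p \<noteq> ?n"
      moreover have "?R (p - ?n)" using p m by (simp add: diff scale)
      ultimately have le: "degree m \<le> degree (p - ?n)" using least by simp
      have "p \<noteq> 0" using p by auto
      have "degree m \<le> degree p" using least \<open>p \<noteq> 0\<close> p by blast
      moreover have "degree p \<le> degree m" using p m by blast
      ultimately have deg: "degree p = degree m" by simp
      have "coeff (p - ?n) (degree m) = 0" using p m deg by simp
      moreover have "degree (p - ?n) \<le> degree m"
        using deg by (intro degree_diff_le) auto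
      ultimately show False using le \<open>p \<noteq> ?n\<close>
        by (metis le_antisym leading_coeff_0_iff right_minus_eq)
    qed
  qed
qed

end

theory Submission
  imports Defs
begin

text \<open>
  Let \<open>Z\<close> be the set of complex conjugates of \<open>\<tau>\<close>. By Newton's identities the polynomial
  with roots \<open>z ^ n\<close> (\<open>z \<in> Z\<close>) is rational, because its power sums are power sums of \<open>Z\<close>; since
  \<open>\<tau> ^ n\<close> is a simple root of it and all its roots are conjugate, it is the minimal polynomial
  of \<open>\<tau> ^ n\<close>. It factors as \<open>x\<^sup>2 - t x + 1\<close> with \<open>t = \<tau> ^ n + \<tau> ^ - n\<close> times a polynomial \<open>U\<close> of
  degree \<open>d - 2\<close> all of whose roots lie on the unit circle, so that the coefficients of \<open>U\<close>
  are bounded by binomial coefficients. Comparing coefficients in this factorisation yields everything.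
\<close>

section \<open>Minimal polynomials over the rationals\<close>

lemma map_poly_of_rat_add:
  "map_poly of_rat (p + q) = (map_poly of_rat p + map_poly of_rat q :: 'a :: field_char_0 poly)"
  by (rule poly_eqI) (simp add: coeff_map_poly of_rat_add)

lemma map_poly_of_rat_mult:
  "map_poly of_rat (p * q) = (map_poly of_rat p * map_poly of_rat q :: 'a :: field_char_0 poly)"
  by (rule poly_eqI) (simp add: coeff_map_poly coeff_mult of_rat_sum of_rat_mult)

lemma map_poly_of_rat_pcompose:
  "map_poly of_rat (pcompose p q) =
    (pcompose (map_poly of_rat p) (map_poly of_rat q) :: 'a :: field_char_0 poly)"
  by (induction p)
    (simp_all add: map_poly_pCons pcompose_pCons map_poly_of_rat_add map_poly_of_rat_mult)

lemma degree_map_poly_of_rat [simp]: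
  "degree (map_poly of_rat p :: 'a :: field_char_0 poly) = degree p"
  by (rule degree_map_poly) simp

lemma map_poly_of_rat_eq_0_iff [simp]:
  "(map_poly of_rat p :: 'a :: field_char_0 poly) = 0 \<longleftrightarrow> p = 0"
  by (auto simp: poly_eq_iff coeff_map_poly)

lemma of_real_of_rat: "of_real (of_rat r) = (of_rat r :: 'a :: real_field)"
  by (cases r) (simp add: of_rat_rat of_real_divide)

lemma poly_map_poly_of_rat_of_real:
  "poly (map_poly of_rat p) (of_real x :: 'a :: real_field) = of_real (poly (map_poly of_rat p) x)"
  by (induction p) (simp_all add: map_poly_pCons of_real_of_rat)

lemma algebraic_if_root_of_rat_poly:
  fixes x :: "'a :: field_char_0"
  assumes "p \<noteq> 0" "poly (map_poly of_rat p) x = 0"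
  shows "algebraic x"
  by (rule algebraicI'[of "map_poly of_rat p"]) (use assms in \<open>auto simp: coeff_map_poly\<close>)

lemma
  fixes x :: "'a :: field_char_0"
  assumes "algebraic x"
  shows lead_coeff_min_rat_poly: "lead_coeff (min_rat_poly x) = 1"
    and poly_min_rat_poly: "poly (map_poly of_rat (min_rat_poly x)) x = 0"
    and degree_min_rat_poly_le:
      "\<And>q. q \<noteq> 0 \<Longrightarrow> poly (map_poly of_rat q) x = 0 \<Longrightarrow> degree (min_rat_poly x) \<le> degree q"
  using theI'[OF min_rat_poly_unique[OF assms]] unfolding min_rat_poly_def by blast+

lemma min_rat_poly_nonzero: "algebraic x \<Longrightarrow> min_rat_poly x \<noteq> 0"
  using lead_coeff_min_rat_poly by fastforce

text \<open>Salem numbers are real, while the root arguments run over the complex numbers; this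
  moves between the two views of \<open>\<tau>\<close>.\<close>

lemma min_rat_poly_of_real: "min_rat_poly (of_real x :: 'a :: real_field) = min_rat_poly x"
  by (simp add: min_rat_poly_def poly_map_poly_of_rat_of_real)

lemma min_rat_poly_dvd:
  fixes x :: "'a :: field_char_0"
  assumes "algebraic x" "poly (map_poly of_rat q) x = 0"
  shows "min_rat_poly x dvd q"
proof (rule ccontr)
  let ?m = "min_rat_poly x"
  assume "\<not> ?m dvd q"
  then have nz: "q mod ?m \<noteq> 0" by (simp add: dvd_eq_mod_eq_0)
  have "poly (map_poly of_rat (q div ?m * ?m + q mod ?m)) x = 0"
    using assms(2) by simp
  then have "poly (map_poly of_rat (q mod ?m)) x = 0"
    unfolding map_poly_of_rat_add map_poly_of_rat_mult by (simp add: poly_min_rat_poly[OF assms(1)])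
  then have "degree ?m \<le> degree (q mod ?m)"
    using degree_min_rat_poly_le[OF assms(1) nz] by blast
  then show False
    using degree_mod_less[OF min_rat_poly_nonzero[OF assms(1)], of q] nz by auto
qed

text \<open>Irreducibility in disguise: \<open>min_rat_poly w\<close> divides
  \<open>min_rat_poly x\<close>, so \<open>x\<close> is a root of it or of the cofactor
  \<open>c\<close>. Minimality of the degree excludes \<open>c\<close> and then forces it to be
  constant; monicity makes it 1.\<close>

lemma min_rat_poly_conjugate:
  fixes x :: "'a :: field_char_0" and w :: "'b :: field_char_0"
  assumes x: "algebraic x" and w: "poly (map_poly of_rat (min_rat_poly x)) w = 0"
  shows "min_rat_poly w = min_rat_poly x"
proof -
  have algw: "algebraic w"
    using algebraic_if_root_of_rat_poly[OF min_rat_poly_nonzero[OF x] w] .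
  obtain c where c: "min_rat_poly x = min_rat_poly w * c"
    using min_rat_poly_dvd[OF algw w] by blast
  have nz: "min_rat_poly w \<noteq> 0" "c \<noteq> 0"
    using min_rat_poly_nonzero[OF x] c by auto
  have deg: "degree (min_rat_poly x) = degree (min_rat_poly w) + degree c"
    unfolding c by (rule degree_mult_eq) (use nz in auto)
  have pos: "degree (min_rat_poly w) > 0"
  proof (rule ccontr)
    assume "\<not> degree (min_rat_poly w) > 0"
    then obtain r where "min_rat_poly w = [:r:]" using degree_eq_zeroE by blast
    then show False
      using poly_min_rat_poly[OF algw] nz by (simp add: map_poly_pCons)
  qed
  have "poly (map_poly of_rat (min_rat_poly w)) x * poly (map_poly of_rat c) x = 0"
    using poly_min_rat_poly[OF x] unfolding c map_poly_of_rat_mult by simp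
  then have "degree (min_rat_poly x) \<le> degree (min_rat_poly w)"
    using degree_min_rat_poly_le[OF x nz(2)] degree_min_rat_poly_le[OF x nz(1)] deg pos by auto
  then have "degree c = 0" using deg by simp
  then obtain r where r: "c = [:r:]" using degree_eq_zeroE by blast
  have "lead_coeff (min_rat_poly x) = lead_coeff (min_rat_poly w) * lead_coeff c"
    unfolding c by (rule lead_coeff_mult)
  then have "r = 1"
    using r lead_coeff_min_rat_poly[OF x] lead_coeff_min_rat_poly[OF algw] by simp
  then show ?thesis using c r by simp
qed

lemma pderiv_map_poly_of_rat:
  "pderiv (map_poly of_rat p) = (map_poly of_rat (pderiv p) :: 'a :: field_char_0 poly)"
  by (rule poly_eqI) (simp add: coeff_pderiv coeff_map_poly of_rat_mult of_rat_add)

text \<open>At a multiple root \<open>w\<close> the derivative would vanish too, so the minimal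
  polynomial of \<open>w\<close>, which is also that of \<open>x\<close>, would divide its own
  nonzero derivative.\<close>

lemma rsquarefree_min_rat_poly:
  fixes x :: "'a :: field_char_0"
  assumes x: "algebraic x"
  shows "rsquarefree (map_poly of_rat (min_rat_poly x) :: 'b :: field_char_0 poly)"
  unfolding rsquarefree_roots
proof (intro allI notI, elim conjE)
  fix w :: 'b
  let ?m = "min_rat_poly x"
  assume w: "poly (map_poly of_rat ?m) w = 0"
    and "poly (pderiv (map_poly of_rat ?m)) w = 0"
  then have w': "poly (map_poly of_rat (pderiv ?m)) w = 0" by (simp add: pderiv_map_poly_of_rat)
  have nz: "?m \<noteq> 0" by (rule min_rat_poly_nonzero[OF x])
  have "degree ?m \<noteq> 0"
  proof
    assume "degree ?m = 0"
    then obtain r where "?m = [:r:]" using degree_eq_zeroE by blast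
    then show False using w nz by (simp add: map_poly_pCons)
  qed
  then have "pderiv ?m \<noteq> 0" by (simp add: pderiv_eq_0_iff)
  moreover have "?m dvd pderiv ?m"
    using min_rat_poly_dvd[OF algebraic_if_root_of_rat_poly[OF nz w] w']
    by (simp add: min_rat_poly_conjugate[OF x w])
  ultimately show False
    using not_dvd_pderiv[OF \<open>degree ?m \<noteq> 0\<close>] by blast
qed

text \<open>Since the roots are simple, the plain set of conjugates can index the factors without
  multiplicities.\<close>

lemma min_rat_poly_eq_prod_conjugates:
  fixes x :: "'a :: field_char_0"
  assumes "algebraic x"
  shows "map_poly of_rat (min_rat_poly x) = (\<Prod>z\<in>alg_conjugates x. [:-z, 1:])"
proof -
  have "coeff (map_poly of_rat (min_rat_poly x) :: complex poly) (degree (min_rat_poly x)) = 1"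
    using lead_coeff_min_rat_poly[OF assms] by (simp add: coeff_map_poly)
  then show ?thesis
    using complex_poly_decompose_rsquarefree[OF rsquarefree_min_rat_poly[OF assms]]
    by (simp add: alg_conjugates_def)
qed

section \<open>Rationality of the polynomial of the powers of the roots\<close>

text \<open>Logarithmic derivatives add over products, and that of 1 - c X is the geometric series
  -c / (1 - c X). Writing R' = R * L avoids division.\<close>

lemma fps_deriv_prod_linear:
  fixes f :: "'i \<Rightarrow> 'a :: field_char_0"
  assumes "finite I"
  shows "fps_deriv (\<Prod>i\<in>I. 1 - fps_const (f i) * fps_X) =
    (\<Prod>i\<in>I. 1 - fps_const (f i) * fps_X) * Abs_fps (\<lambda>k. - (\<Sum>i\<in>I. f i ^ Suc k))"
  using assms
proof (induction I)
  case empty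
  show ?case by (simp add: fps_eq_iff)
next
  case (insert j I)
  let ?R = "\<Prod>i\<in>I. 1 - fps_const (f i) * fps_X"
  let ?c = "f j"
  let ?A = "1 - fps_const ?c * fps_X"
  let ?M = "Abs_fps (\<lambda>k. - (?c ^ Suc k))" and ?L = "Abs_fps (\<lambda>k. - (\<Sum>i\<in>I. f i ^ Suc k))"
  have "- fps_const ?c = ?A * ?M"
  proof (rule fps_ext)
    show "(- fps_const ?c) $ k = (?A * ?M) $ k" for k
      by (cases k) (simp_all add: left_diff_distrib mult.assoc)
  qed
  then have A: "fps_deriv ?A = ?A * ?M" by simp
  have L: "Abs_fps (\<lambda>k. - (\<Sum>i\<in>insert j I. f i ^ Suc k)) = ?M + ?L"
    using insert.hyps by (simp add: fps_eq_iff)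
  have "(\<Prod>i\<in>insert j I. 1 - fps_const (f i) * fps_X) = ?A * ?R"
    using insert.hyps by simp
  moreover have "fps_deriv (?A * ?R) = ?A * ?R * (?M + ?L)"
    unfolding fps_deriv_mult A insert.IH by (simp only: algebra_simps)
  ultimately show ?case unfolding L by simp
qed

text \<open>Comparing coefficients in R' = R * L gives a recursion. As \<open>R $ 0 = 1\<close>, it
  can be solved for the next coefficient of either series by rational operations.\<close>

lemma fps_Rats_iff_log_deriv_Rats:
  fixes R L :: "'a :: field_char_0 fps"
  assumes R0: "R $ 0 = 1" and deriv: "fps_deriv R = R * L"
  shows "(\<forall>k. R $ k \<in> \<rat>) \<longleftrightarrow> (\<forall>k. L $ k \<in> \<rat>)"
proof -
  have eq: "of_nat (Suc k) * R $ Suc k = (\<Sum>i=0..k. R $ i * L $ (k - i))" for k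
    using arg_cong[OF deriv, of "\<lambda>F. F $ k"] by (simp add: fps_mult_nth)
  show ?thesis
  proof (intro iffI allI)
    fix k assume R: "\<forall>k. R $ k \<in> \<rat>"
    show "L $ k \<in> \<rat>"
    proof (induction k rule: less_induct)
      case (less k)
      have "(\<Sum>i=0..k. R $ i * L $ (k - i)) = L $ k + (\<Sum>i=1..k. R $ i * L $ (k - i))"
        by (simp add: sum.atLeast_Suc_atMost R0)
      then have "L $ k = of_nat (Suc k) * R $ Suc k - (\<Sum>i=1..k. R $ i * L $ (k - i))"
        using eq[of k] by (simp add: algebra_simps)
      also have "\<dots> \<in> \<rat>"
        using R less by (intro Rats_diff Rats_mult Rats_sum) auto
      finally show ?case .
    qed
  next
    fix k assume L: "\<forall>k. L $ k \<in> \<rat>"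
    show "R $ k \<in> \<rat>"
    proof (induction k rule: less_induct)
      case (less k)
      show ?case
      proof (cases k)
        case 0
        then show ?thesis by (simp add: R0)
      next
        case (Suc j)
        have "R $ Suc j = (\<Sum>i=0..j. R $ i * L $ (j - i)) / of_nat (Suc j)"
          using eq[of j] by (simp add: field_simps del: of_nat_Suc)
        also have "\<dots> \<in> \<rat>"
          using L less Suc by (intro Rats_divide Rats_sum Rats_mult) auto
        finally show ?thesis using Suc by simp
      qed
    qed
  qed
qed

text \<open>Newton's identities in generating function form: the logarithmic derivative of the reversed
  polynomial generates the (negated) power sums.\<close>

lemma prod_linear_Rats_iff_power_sums_Rats:
  fixes f :: "'i \<Rightarrow> 'a :: field_char_0"
  assumes fin: "finite I"
  shows "(\<forall>k. coeff (\<Prod>i\<in>I. [:- f i, 1:]) k \<in> \<rat>) \<longleftrightarrow> (\<forall>k. (\<Sum>i\<in>I. f i ^ Suc k) \<in> \<rat>)"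
proof -
  let ?p = "\<Prod>i\<in>I. [:- f i, 1:]"
  let ?R = "\<Prod>i\<in>I. 1 - fps_const (f i) * fps_X"
  have "reflect_poly [:- c, 1:] = [:1, - c:]" for c :: 'a
    by (rule poly_eqI) (auto simp: coeff_reflect_poly coeff_pCons split: nat.split)
  \<comment> \<open>Reversal turns x - c into 1 - c x, so the product becomes a power series with
    constant coefficient 1.\<close>
  then have lin: "fps_of_poly (reflect_poly [:- c, 1:]) = 1 - fps_const c * fps_X" for c :: 'a
    by (simp add: fps_of_poly_linear' flip: fps_const_neg)
  have R: "?R = fps_of_poly (reflect_poly ?p)"
    by (simp only: reflect_poly_prod fps_of_poly_prod lin)
  have R0: "?R $ 0 = 1"
    using fin by induction simp_all
  have Rk: "?R $ k = (if k > degree ?p then 0 else coeff ?p (degree ?p - k))" for k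
    unfolding R by (simp add: coeff_reflect_poly)
  have "(\<forall>k. coeff ?p k \<in> \<rat>) \<longleftrightarrow> (\<forall>k. ?R $ k \<in> \<rat>)"
  proof
    assume *: "\<forall>k. ?R $ k \<in> \<rat>"
    show "\<forall>k. coeff ?p k \<in> \<rat>"
    proof
      fix k
      show "coeff ?p k \<in> \<rat>"
      proof (cases "k \<le> degree ?p")
        case True
        then have "?R $ (degree ?p - k) = coeff ?p k" unfolding Rk by simp
        then show ?thesis using * by metis
      qed (simp add: coeff_eq_0)
    qed
  qed (simp add: Rk)
  also have "\<dots> \<longleftrightarrow> (\<forall>k. Abs_fps (\<lambda>k. - (\<Sum>i\<in>I. f i ^ Suc k)) $ k \<in> \<rat>)"
    by (rule fps_Rats_iff_log_deriv_Rats[OF R0 fps_deriv_prod_linear[OF fin]])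
  also have "\<dots> \<longleftrightarrow> (\<forall>k. (\<Sum>i\<in>I. f i ^ Suc k) \<in> \<rat>)"
    by simp
  finally show ?thesis .
qed

text \<open>Every power sum of the \<open>f i ^ n\<close> is itself a power sum of the
  \<open>f i\<close>, with exponent multiplied by n.\<close>

lemma prod_linear_powers_Rats:
  fixes f :: "'i \<Rightarrow> 'a :: field_char_0"
  assumes "finite I" and "\<And>k. coeff (\<Prod>i\<in>I. [:- f i, 1:]) k \<in> \<rat>"
  shows "coeff (\<Prod>i\<in>I. [:- (f i ^ n), 1:]) k \<in> \<rat>"
proof -
  have sums: "(\<Sum>i\<in>I. f i ^ Suc k) \<in> \<rat>" for k
    using prod_linear_Rats_iff_power_sums_Rats[OF assms(1), of f] assms(2) by blast
  have "(\<Sum>i\<in>I. (f i ^ n) ^ Suc k) \<in> \<rat>" for k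
  proof (cases "n * Suc k")
    \<comment> \<open>Newton's identities cover positive exponents only. Exponent 0, which occurs
      for n = 0, is left to the other case, where the sum is a cardinality.\<close>
    case (Suc j)
    then show ?thesis using sums[of j] by (simp only: flip: power_mult)
  qed (simp only: flip: power_mult, simp)
  then show ?thesis
    using prod_linear_Rats_iff_power_sums_Rats[OF assms(1), of "\<lambda>i. f i ^ n"] by blast
qed

text \<open>In general the product is a power of the minimal polynomial of \<open>x ^ n\<close>. The
  last hypothesis makes \<open>x ^ n\<close> a simple root, so the exponent is 1.\<close>

lemma min_rat_poly_power:
  fixes x :: complex
  assumes x: "algebraic x" and n: "n \<ge> 1"
    and inj: "\<And>z. z \<in> alg_conjugates x \<Longrightarrow> z ^ n = x ^ n \<Longrightarrow> z = x"
  shows "map_poly of_rat (min_rat_poly (x ^ n)) = (\<Prod>z\<in>alg_conjugates x. [:- (z ^ n), 1:])"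
proof -
  let ?Z = "alg_conjugates x"
  let ?Q = "\<Prod>z\<in>?Z. [:- (z ^ n), 1:]"
  have fin: "finite ?Z"
    unfolding alg_conjugates_def by (rule poly_roots_finite) (simp add: min_rat_poly_nonzero[OF x])
  have xZ: "x \<in> ?Z"
    using poly_min_rat_poly[OF x] by (simp add: alg_conjugates_def)
  have Q0: "?Q \<noteq> 0" using fin by simp
  have "coeff (\<Prod>z\<in>?Z. [:- z, 1:]) k \<in> \<rat>" for k
    by (simp add: coeff_map_poly flip: min_rat_poly_eq_prod_conjugates[OF x])
  then obtain q where q: "?Q = map_poly of_rat q"
    using prod_linear_powers_Rats[OF fin, of "\<lambda>z. z" n] ratpolyE by blast
  have Qroot: "poly ?Q w = 0 \<longleftrightarrow> (\<exists>z\<in>?Z. w = z ^ n)" for w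
    using fin by (auto simp: poly_prod)
  have alg: "algebraic (x ^ n)"
    using algebraic_if_root_of_rat_poly[of q "x ^ n"] Q0 Qroot[of "x ^ n"] xZ unfolding q by auto
  let ?m = "min_rat_poly (x ^ n)"
  \<comment> \<open>Substituting y^n into \<open>?m\<close> gives a rational polynomial vanishing at
    \<open>x\<close>, hence at all conjugates of \<open>x\<close>.\<close>
  have conj: "poly (map_poly of_rat ?m) (z ^ n) = 0" if z: "z \<in> ?Z" for z
  proof -
    let ?c = "pcompose ?m (monom 1 n)"
    have eval: "poly (map_poly of_rat ?c) y = poly (map_poly of_rat ?m) (y ^ n)" for y :: complex
      by (simp add: map_poly_of_rat_pcompose map_poly_monom poly_pcompose poly_monom)
    have "min_rat_poly x dvd ?c"
      using min_rat_poly_dvd[OF x] eval poly_min_rat_poly[OF alg] by simp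
    then obtain r where "?c = min_rat_poly x * r" by blast
    then have "poly (map_poly of_rat ?c) z = 0"
      using z by (simp add: map_poly_of_rat_mult alg_conjugates_def)
    then show ?thesis by (simp add: eval)
  qed
  have "poly (map_poly of_rat q) (x ^ n) = 0"
    using Qroot[of "x ^ n"] xZ unfolding q by auto
  then obtain h where h: "q = ?m * h"
    using min_rat_poly_dvd[OF alg] by blast
  \<comment> \<open>A root of \<open>h\<close> would be some \<open>z ^ n\<close>, a conjugate of
    \<open>x ^ n\<close>. Then \<open>?m\<close> would divide \<open>h\<close> as well, and
    \<open>x ^ n\<close> would be a double root of \<open>?Q\<close>.\<close>
  have "degree h = 0"
  proof (rule ccontr)
    assume "degree h \<noteq> 0"
    then have "\<not> constant (poly (map_poly of_rat h :: complex poly))"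
      by (simp add: constant_degree)
    then obtain w :: complex where w: "poly (map_poly of_rat h) w = 0"
      using fundamental_theorem_of_algebra by blast
    then have "poly ?Q w = 0" unfolding q h by (simp add: map_poly_of_rat_mult)
    then obtain z where "z \<in> ?Z" "w = z ^ n" using iffD1[OF Qroot] by blast
    then have m_w: "poly (map_poly of_rat ?m) w = 0" using conj[of z] by simp
    have "?m dvd h"
      using min_rat_poly_dvd[OF algebraic_if_root_of_rat_poly[OF min_rat_poly_nonzero[OF alg] m_w] w]
      by (simp add: min_rat_poly_conjugate[OF alg m_w])
    then obtain r where "h = ?m * r" by blast
    then have "poly (map_poly of_rat h) (x ^ n) = 0"
      using poly_min_rat_poly[OF alg] by (simp add: map_poly_of_rat_mult)
    then have "poly (pderiv ?Q) (x ^ n) = 0"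
      using poly_min_rat_poly[OF alg] unfolding q h by (simp add: map_poly_of_rat_mult pderiv_mult)
    \<comment> \<open>With the factor of \<open>x\<close> split off, the derivative at
      \<open>x ^ n\<close> is the product of the differences \<open>x ^ n - z ^ n\<close>.\<close>
    moreover have "?Q = [:- (x ^ n), 1:] * (\<Prod>z\<in>?Z - {x}. [:- (z ^ n), 1:])"
      by (rule prod.remove[OF fin xZ])
    then have "poly (pderiv ?Q) (x ^ n) = poly (\<Prod>z\<in>?Z - {x}. [:- (z ^ n), 1:]) (x ^ n)"
      by (simp add: pderiv_mult pderiv_pCons del: mult_pCons_left)
    ultimately have "(\<Prod>z\<in>?Z - {x}. x ^ n - z ^ n) = 0" by (simp add: poly_prod)
    then obtain z where "z \<in> ?Z - {x}" "x ^ n = z ^ n" using fin by auto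
    then show False using inj[of z] by simp
  qed
  then obtain r where r: "h = [:r:]" using degree_eq_zeroE by blast
  have "lead_coeff ?Q = 1" by (simp add: lead_coeff_prod)
  then have "lead_coeff q = 1" unfolding q by (simp add: coeff_map_poly)
  moreover have "lead_coeff q = lead_coeff ?m * lead_coeff h"
    unfolding h by (rule lead_coeff_mult)
  ultimately have "r = 1" using lead_coeff_min_rat_poly[OF alg] r by simp
  then show ?thesis using q h r by simp
qed

section \<open>Coefficients of the minimal polynomial of a power of a Salem number\<close>

text \<open>The extreme case is (1 + x)^m with m = \<open>card I\<close>; the induction step is
  Pascal's rule.\<close>

lemma norm_coeff_prod_linear_le:
  fixes f :: "'i \<Rightarrow> 'a :: real_normed_field"
  assumes "finite I" and "\<And>i. i \<in> I \<Longrightarrow> norm (f i) \<le> 1"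
  shows "norm (coeff (\<Prod>i\<in>I. [:- f i, 1:]) k) \<le> real (card I choose k)"
  using assms
proof (induction I arbitrary: k)
  case empty
  show ?case by (cases k) simp_all
next
  case (insert j I)
  let ?p = "\<Prod>i\<in>I. [:- f i, 1:]"
  have IH: "norm (coeff ?p k) \<le> real (card I choose k)" for k
    using insert by simp
  have j: "norm (f j * coeff ?p k) \<le> real (card I choose k)" for k
    unfolding norm_mult using insert.prems[of j] IH[of k] mult_mono[of "norm (f j)" 1] by fastforce
  have "(\<Prod>i\<in>insert j I. [:- f i, 1:]) = [:- f j, 1:] * ?p" using insert.hyps by simp
  moreover have "norm (coeff ([:- f j, 1:] * ?p) k) \<le> real (card (insert j I) choose k)"
  proof (cases k)
    case 0
    then show ?thesis using j[of 0] by simp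
  next
    case (Suc l)
    have "norm (coeff ([:- f j, 1:] * ?p) k) \<le> norm (coeff ?p l) + norm (f j * coeff ?p k)"
      using Suc norm_triangle_ineq4[of "coeff ?p l" "f j * coeff ?p k"] by simp
    then show ?thesis using Suc IH[of l] j[of k] insert.hyps by simp
  qed
  ultimately show ?case by simp
qed

lemma coeff_prod_linear_degree_minus_1:
  fixes f :: "'i \<Rightarrow> 'a :: idom"
  assumes "finite I" "I \<noteq> {}"
  shows "coeff (\<Prod>i\<in>I. [:- f i, 1:]) (card I - 1) = - (\<Sum>i\<in>I. f i)"
  using assms
proof (induction I rule: finite_ne_induct)
  case (insert j I)
  let ?p = "\<Prod>i\<in>I. [:- f i, 1:]"
  have "degree ?p = card I" by (subst degree_prod_eq_sum_degree) auto
  then have "coeff ?p (card I) = 1" using lead_coeff_prod[of "\<lambda>i. [:- f i, 1:]" I] by simp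
  moreover obtain l where "card I = Suc l" using insert.hyps by (cases "card I") auto
  ultimately show ?case using insert by simp
qed simp

text \<open>\<open>V\<close> collects the conjugates of \<open>\<tau>\<close> itself on the unit
  circle, so its size is known directly. The remaining pair has n-th powers with product 1, which
  gives the quadratic factor.\<close>

lemma min_rat_poly_salem_power:
  assumes salem: "salem_number \<tau>" and n: "n \<ge> 1"
  obtains V :: "complex set" where "finite V" "card V = alg_degree \<tau> - 2"
    "\<And>v. v \<in> V \<Longrightarrow> cmod v = 1"
    "map_poly of_rat (min_rat_poly (\<tau> ^ n)) =
      [:1, - complex_of_real (\<tau> ^ n + inverse (\<tau> ^ n)), 1:] * (\<Prod>v\<in>V. [:- (v ^ n), 1:])"
proof -
  let ?Z = "alg_conjugates \<tau>"
  let ?t = "complex_of_real \<tau>"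
  let ?V = "?Z - {?t, inverse ?t}"
  have algr: "algebraic \<tau>" and gt: "\<tau> > 1" and inv: "inverse ?t \<in> ?Z"
    and unit: "\<And>z. z \<in> ?V \<Longrightarrow> cmod z = 1"
    using salem by (auto simp: salem_number_def)
  have alg: "algebraic ?t" using algr by (rule algebraic_of_real)
  have Z: "alg_conjugates ?t = ?Z"
    unfolding alg_conjugates_def by (simp add: min_rat_poly_of_real)
  have fin: "finite ?Z"
    unfolding alg_conjugates_def by (rule poly_roots_finite) (simp add: min_rat_poly_nonzero[OF algr])
  have tZ: "?t \<in> ?Z"
    using poly_min_rat_poly[OF alg] unfolding Z[symmetric] by (simp add: alg_conjugates_def)
  have "inverse \<tau> < 1" using gt by (simp add: field_simps)
  then have neq: "inverse ?t \<noteq> ?t" using gt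
    by (metis less_trans less_irrefl of_real_eq_iff of_real_inverse)
  have "alg_degree \<tau> = degree (\<Prod>z\<in>?Z. [:- z, 1:])"
    by (simp add: alg_degree_def flip: min_rat_poly_eq_prod_conjugates[OF algr])
  also have "\<dots> = card ?Z" by (subst degree_prod_eq_sum_degree) auto
  finally have card: "card ?V = alg_degree \<tau> - 2"
    using tZ inv neq by (simp add: card_Diff_subset)
  \<comment> \<open>Equal n-th powers have equal absolute values, and \<open>?t\<close> is the only
    conjugate outside the closed unit disc.\<close>
  have "z = ?t" if z: "z \<in> ?Z" "z ^ n = ?t ^ n" for z
  proof -
    have "cmod z ^ n = cmod ?t ^ n" using z(2) by (metis norm_power)
    then have "cmod z = cmod ?t" using n power_eq_imp_eq_base[of "cmod z" n "cmod ?t"] by simp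
    then have "cmod z > 1" using gt by simp
    moreover have "cmod (inverse ?t) < 1" using \<open>inverse \<tau> < 1\<close> gt by (simp add: norm_inverse)
    ultimately show ?thesis using unit[of z] z(1) by force
  qed
  then have "map_poly of_rat (min_rat_poly (?t ^ n)) = (\<Prod>z\<in>?Z. [:- (z ^ n), 1:])"
    using min_rat_poly_power[OF alg n] unfolding Z by blast
  also have "min_rat_poly (?t ^ n) = min_rat_poly (\<tau> ^ n)"
    by (simp only: min_rat_poly_of_real flip: of_real_power)
  also have "?Z = insert ?t (insert (inverse ?t) ?V)" using tZ inv by auto
  also have "(\<Prod>z\<in>\<dots>. [:- (z ^ n), 1:]) =
      [:- (?t ^ n), 1:] * ([:- (inverse ?t ^ n), 1:] * (\<Prod>v\<in>?V. [:- (v ^ n), 1:]))"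
    using fin neq by (simp del: mult_pCons_left)
  also have "\<dots> = ([:- (?t ^ n), 1:] * [:- (inverse ?t ^ n), 1:]) * (\<Prod>v\<in>?V. [:- (v ^ n), 1:])"
    by (simp only: mult.assoc)
  also have "[:- (?t ^ n), 1:] * [:- (inverse ?t ^ n), 1:] =
      [:1, - complex_of_real (\<tau> ^ n + inverse (\<tau> ^ n)), 1:]"
    using gt by (simp add: power_inverse)
  finally show ?thesis using that[of ?V] fin card unit by blast
qed

text \<open>Multiplying \<open>U\<close> by x^2 - t x + 1 makes each coefficient of index at least 2
  a combination of three neighbouring coefficients of \<open>U\<close>; these produce the three
  binomials.\<close>

lemma salem_power_coeff_bounds:
  fixes \<tau> :: real and n :: nat
  defines "d \<equiv> alg_degree \<tau>" and "t \<equiv> \<tau> ^ n + inverse (\<tau> ^ n)"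
    and "c \<equiv> \<lambda>j. real_of_rat (coeff (min_rat_poly (\<tau> ^ n)) j)"
  assumes salem: "salem_number \<tau>" and n: "n \<ge> 1"
  shows "\<bar>c (d - 1) + t\<bar> \<le> real d - 2"
    and "\<And>k. k \<in> {1..d - 3} \<Longrightarrow> \<bar>c (d - k - 1)\<bar> \<le> real ((d - 2) choose k) * t
      + real ((d - 2) choose (k - 1)) + real ((d - 2) choose (k + 1))"
proof -
  obtain V :: "complex set" where V: "finite V" "card V = d - 2" "\<And>v. v \<in> V \<Longrightarrow> cmod v = 1"
    and eq: "map_poly of_rat (min_rat_poly (\<tau> ^ n)) =
      [:1, - complex_of_real t, 1:] * (\<Prod>v\<in>V. [:- (v ^ n), 1:])"
    using min_rat_poly_salem_power[OF salem n] unfolding d_def t_def by metis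
  define U where "U = (\<Prod>v\<in>V. [:- (v ^ n), 1:])"
  have d: "d \<ge> 4" and "\<tau> > 1" using salem by (auto simp: salem_number_def d_def)
  then have t: "t \<ge> 0" by (simp add: t_def)
  have norm: "cmod (v ^ n) = 1" if "v \<in> V" for v using V(3)[OF that] by (simp add: norm_power)
  have U: "cmod (coeff U j) \<le> real ((d - 2) choose j)" for j
    unfolding U_def V(2)[symmetric]
    by (rule norm_coeff_prod_linear_le) (use V(1) norm in auto)
  have c: "complex_of_real (c (Suc (Suc j))) = coeff U j - t * coeff U (Suc j) + coeff U (Suc (Suc j))" for j
  proof -
    have "complex_of_real (c (Suc (Suc j))) =
        coeff (map_poly of_rat (min_rat_poly (\<tau> ^ n))) (Suc (Suc j))"
      by (simp add: c_def coeff_map_poly of_real_of_rat)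
    also have "\<dots> = coeff ([:1, - complex_of_real t, 1:] * U) (Suc (Suc j))"
      unfolding eq U_def ..
    finally show ?thesis by simp
  qed
  have degU: "degree U = d - 2"
    unfolding U_def V(2)[symmetric] by (subst degree_prod_eq_sum_degree) auto
  then have lead: "coeff U (d - 2) = 1"
    using lead_coeff_prod[of "\<lambda>v. [:- (v ^ n), 1:]" V] by (simp add: U_def)
  have "V \<noteq> {}" using V d by auto
  then have sub: "coeff U (d - 3) = - (\<Sum>v\<in>V. v ^ n)"
    using coeff_prod_linear_degree_minus_1[OF V(1), of "\<lambda>v. v ^ n"] V(2) by (simp add: U_def)
  have idx: "Suc (d - 2) = d - 1" "Suc (d - 3) = d - 2" using d by auto
  \<comment> \<open>Here j = d - 3: \<open>U\<close> is monic of degree d - 2, so the middle term is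
    -t and the last one vanishes.\<close>
  have "complex_of_real (c (d - 1) + t) = - (\<Sum>v\<in>V. v ^ n)"
    using c[of "d - 3", unfolded idx sub lead] degU d by (simp add: coeff_eq_0)
  then have "\<bar>c (d - 1) + t\<bar> = cmod (\<Sum>v\<in>V. v ^ n)"
    by (metis norm_minus_cancel norm_of_real)
  also have "\<dots> \<le> (\<Sum>v\<in>V. 1)" by (rule sum_norm_le) (simp add: norm)
  finally show "\<bar>c (d - 1) + t\<bar> \<le> real d - 2" using V(2) d by simp
  fix k assume k: "k \<in> {1..d - 3}"
  \<comment> \<open>The index d - k - 1 becomes j + 2; the subtraction is exact because k is at most
    d - 3.\<close>
  define j where "j = d - 3 - k"
  have j: "d - k - 1 = Suc (Suc j)" "d - 2 = Suc j + k" using k d by (auto simp: j_def)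
  \<comment> \<open>Symmetry of the binomials: the complements of j, j + 1, j + 2 in d - 2 are k +
    1, k, k - 1, the last being genuine as k is positive.\<close>
  have binom: "(d - 2) choose j = (d - 2) choose (k + 1)" "(d - 2) choose Suc j = (d - 2) choose k"
    "(d - 2) choose Suc (Suc j) = (d - 2) choose (k - 1)"
    using k j(2) binomial_symmetric[of j "d - 2"] binomial_symmetric[of "Suc j" "d - 2"]
      binomial_symmetric[of "Suc (Suc j)" "d - 2"] by (simp_all del: binomial_Suc_Suc)
  have "\<bar>c (d - k - 1)\<bar> = cmod (coeff U j - t * coeff U (Suc j) + coeff U (Suc (Suc j)))"
    unfolding j(1) c[symmetric] by (rule norm_of_real[symmetric])
  also have "\<dots> \<le> cmod (coeff U j) + cmod (t * coeff U (Suc j)) + cmod (coeff U (Suc (Suc j)))"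
    by (meson add_right_mono norm_triangle_ineq norm_triangle_ineq4 order_trans)
  also have "cmod (t * coeff U (Suc j)) = t * cmod (coeff U (Suc j))"
    using t by (simp add: norm_mult)
  also have "t * cmod (coeff U (Suc j)) \<le> t * real ((d - 2) choose Suc j)"
    using t U by (intro mult_left_mono)
  finally show "\<bar>c (d - k - 1)\<bar> \<le> real ((d - 2) choose k) * t
      + real ((d - 2) choose (k - 1)) + real ((d - 2) choose (k + 1))"
    using U[of j] U[of "Suc (Suc j)"] unfolding binom by (simp add: mult.commute)
qed

section \<open>Sequences asymptotic to a geometric one\<close>

text \<open>Eventually \<open>b n\<close> lies between the positive constants l / 2 and 2 l, whose
  n-th roots tend to 1.\<close>

lemma tendsto_root_of_tendsto_pos:
  fixes b :: "nat \<Rightarrow> real"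
  assumes b: "b \<longlonglongrightarrow> l" and l: "l > 0"
  shows "(\<lambda>n. root n (b n)) \<longlonglongrightarrow> 1"
proof (rule real_tendsto_sandwich)
  have "\<forall>\<^sub>F n in sequentially. b n > l / 2" "\<forall>\<^sub>F n in sequentially. b n < 2 * l"
    using order_tendstoD(1)[OF b, of "l / 2"] order_tendstoD(2)[OF b, of "2 * l"] l by simp_all
  then show "\<forall>\<^sub>F n in sequentially. root n (l / 2) \<le> root n (b n)"
    and "\<forall>\<^sub>F n in sequentially. root n (b n) \<le> root n (2 * l)"
    using eventually_gt_at_top[of 0] by (eventually_elim; simp)+
qed (use l in \<open>auto intro: LIMSEQ_root_const\<close>)

lemma
  fixes b :: "nat \<Rightarrow> real"
  assumes r: "r > 0" and b: "(\<lambda>n. b n / r ^ n) \<longlonglongrightarrow> l" and l: "l \<noteq> 0"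
  shows tendsto_ratio_of_asymp_geometric: "(\<lambda>n. b (n + 1) / b n) \<longlonglongrightarrow> r"
    and tendsto_root_of_asymp_geometric: "(\<lambda>n. root n \<bar>b n\<bar>) \<longlonglongrightarrow> r"
proof -
  have "(\<lambda>n. b (n + 1) / r ^ (n + 1)) \<longlonglongrightarrow> l"
    using LIMSEQ_ignore_initial_segment[OF b, of 1] .
  then have "(\<lambda>n. r * ((b (n + 1) / r ^ (n + 1)) / (b n / r ^ n))) \<longlonglongrightarrow> r * (l / l)"
    using b l by (intro tendsto_intros)
  \<comment> \<open>The powers of \<open>r\<close> cancel for every n: where \<open>b n\<close> is
    0, both sides are 0 by the convention on division.\<close>
  then show "(\<lambda>n. b (n + 1) / b n) \<longlonglongrightarrow> r"
    using r l by simp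
  have "(\<lambda>n. root n \<bar>b n / r ^ n\<bar>) \<longlonglongrightarrow> 1"
    by (rule tendsto_root_of_tendsto_pos[OF tendsto_rabs[OF b]]) (use l in simp)
  then have "(\<lambda>n. r * root n \<bar>b n / r ^ n\<bar>) \<longlonglongrightarrow> r"
    using tendsto_mult[OF tendsto_const, of _ 1 sequentially r] by simp
  \<comment> \<open>Cancelling \<open>root n (r ^ n)\<close> to \<open>r\<close> needs n > 0, as
    \<open>root 0\<close> is 0.\<close>
  moreover have "\<forall>\<^sub>F n in sequentially. r * root n \<bar>b n / r ^ n\<bar> = root n \<bar>b n\<bar>"
    using eventually_gt_at_top[of 0]
    by eventually_elim (use r in \<open>simp add: real_root_divide real_root_power_cancel abs_divide power_abs\<close>)
  ultimately show "(\<lambda>n. root n \<bar>b n\<bar>) \<longlonglongrightarrow> r"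
    by (rule Lim_transform_eventually)
qed

section \<open>Limits and bounds for the coefficients along the powers of a Salem number\<close>

theorem theorem3:
  fixes \<tau> :: real and d :: nat and P :: "nat \<Rightarrow> rat poly" and a :: "nat \<Rightarrow> nat \<Rightarrow> real"
  assumes "salem_number \<tau>"
    and "d = alg_degree \<tau>"
    and "\<And>n. n \<ge> 1 \<Longrightarrow> P n = min_rat_poly (\<tau> ^ n)"
    and "\<And>j n. a j n = of_rat (coeff (P n) j)"
  shows "((\<lambda>n. a (d - 1) (n + 1) / a (d - 1) n) \<longlonglongrightarrow> \<tau> \<and>
          (\<lambda>n. root n \<bar>a (d - 1) n\<bar>) \<longlonglongrightarrow> \<tau>) \<and>
         (\<forall>n \<ge> 1. \<tau> ^ n + inverse (\<tau> ^ n) \<le> \<bar>a (d - 1) n\<bar> + real d - 2) \<and>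
         (\<forall>n \<ge> 1. \<forall>k \<in> {1..d - 3}.
            \<bar>a (d - k - 1) n\<bar> \<le> real ((d - 2) choose k) * (\<bar>a (d - 1) n\<bar> + real d - 2)
              + real ((d - 2) choose (k - 1)) + real ((d - 2) choose (k + 1)))"
proof -
  let ?t = "\<lambda>n. \<tau> ^ n + inverse (\<tau> ^ n)"
  have d: "d \<ge> 4" and gt: "\<tau> > 1" using assms(1,2) by (auto simp: salem_number_def)
  have a: "a j n = real_of_rat (coeff (min_rat_poly (\<tau> ^ n)) j)" if "n \<ge> 1" for j n
    using assms(3)[OF that] assms(4) by simp
  \<comment> \<open>Up to a bounded error the coefficient is minus \<open>?t n\<close>; both limits
    and (b) rest on this.\<close>
  have trace: "\<bar>a (d - 1) n + ?t n\<bar> \<le> real d - 2" if "n \<ge> 1" for n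
    using salem_power_coeff_bounds(1)[OF assms(1) that] unfolding assms(2) a[OF that] .
  have b: "?t n \<le> \<bar>a (d - 1) n\<bar> + real d - 2" if "n \<ge> 1" for n
    using trace[OF that] by linarith
  have c: "\<bar>a (d - k - 1) n\<bar> \<le> real ((d - 2) choose k) * (\<bar>a (d - 1) n\<bar> + real d - 2)
      + real ((d - 2) choose (k - 1)) + real ((d - 2) choose (k + 1))"
    if n: "n \<ge> 1" and k: "k \<in> {1..d - 3}" for n k
  proof -
    have "\<bar>a (d - k - 1) n\<bar> \<le> real ((d - 2) choose k) * ?t n
        + real ((d - 2) choose (k - 1)) + real ((d - 2) choose (k + 1))"
      using salem_power_coeff_bounds(2)[OF assms(1) n] k unfolding assms(2) a[OF n] by blast
    \<comment> \<open>Part (b) trades \<open>?t n\<close> for the coefficient itself.\<close>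
    moreover have "real ((d - 2) choose k) * ?t n \<le>
        real ((d - 2) choose k) * (\<bar>a (d - 1) n\<bar> + real d - 2)"
      by (rule mult_left_mono[OF b[OF n]]) simp
    ultimately show ?thesis by linarith
  qed
  have inv: "(\<lambda>n. inverse (\<tau> ^ n)) \<longlonglongrightarrow> 0"
    using LIMSEQ_inverse_realpow_zero[OF gt] .
  \<comment> \<open>Dropping \<open>inverse (\<tau> ^ n)\<close>, which is at most 1, from
    \<open>?t n\<close> raises the error bound from d - 2 to d - 1.\<close>
  have "\<forall>\<^sub>F n in sequentially. norm (a (d - 1) n / \<tau> ^ n + 1) \<le> norm (inverse (\<tau> ^ n)) * (real d - 1)"
    using eventually_ge_at_top[of 1]
  proof eventually_elim
    case (elim n)
    have pos: "\<tau> ^ n > 0" using gt by simp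
    have "inverse (\<tau> ^ n) \<le> 1" "inverse (\<tau> ^ n) > 0" using gt by (simp_all add: inverse_le_1_iff)
    then have "\<bar>a (d - 1) n + \<tau> ^ n\<bar> \<le> real d - 1" using trace[OF elim] by linarith
    moreover have "norm (a (d - 1) n / \<tau> ^ n + 1) = \<bar>a (d - 1) n + \<tau> ^ n\<bar> * inverse (\<tau> ^ n)"
    proof -
      have "a (d - 1) n / \<tau> ^ n + 1 = (a (d - 1) n + \<tau> ^ n) * inverse (\<tau> ^ n)"
        using gt by (simp add: distrib_right divide_inverse)
      then show ?thesis using pos by (simp add: abs_mult)
    qed
    ultimately show ?case using pos by (simp add: mult.commute divide_right_mono)
  qed
  then have "(\<lambda>n. a (d - 1) n / \<tau> ^ n + 1) \<longlonglongrightarrow> 0"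
    by (rule tendsto_0_le[OF inv])
  then have "(\<lambda>n. a (d - 1) n / \<tau> ^ n) \<longlonglongrightarrow> - 1"
    using tendsto_diff[OF _ tendsto_const, of _ 0 sequentially 1] by fastforce
  then show ?thesis
    using b c tendsto_ratio_of_asymp_geometric[of \<tau> "a (d - 1)" "- 1"]
      tendsto_root_of_asymp_geometric[of \<tau> "a (d - 1)" "- 1"] gt by auto
qed

end
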